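(* Let $n\ge 1$, $\mu>0$, and consider the dynamical system $\dot z=F(z)$ on the polydisc $\mathbb{D}^n(\mu)\subset\mathbb{C}^n$ with polynomial vector field $F=(F_1,\dots,F_n)$, $$\dot z_l=F_l(z)=\sum_{k=1}^r a_{l,k}\,z^{\alpha(k)},\qquad l=1,\dots,n,\quad a_{l,k}\in\mathbb{C}.$$ Assume that: (1) the components $F_l$ are holomorphic on the closed polydisc $\overline{\mathbb{D}^n(\mu)}$, belong to the Hardy space $\mathbb{H}^2(\mathbb{D}^n(\mu))$, and $F$ generates a flow $\varphi^t$ ($t\ge 0$) that is holomorphic on $\mathbb{D}^n(\mu)$ and maps $\mathbb{D}^n(\mu)$ to itself; (2) $0$ is the unique equilibrium of $F$ in $\mathbb{D}^n(\mu)$, it is hyperbolic, and all eigenvalues $\tilde\lambda_j$ of the Jacobian matrix $JF(0)$ satisfy $\Re(\tilde\lambda_j)<0$; (3) the Jacobian matrix $JF(0)$ is diagonal. Define $$d=\max\{|\alpha(k)| : a_{l,k}\neq 0 \text{ for some } l\}=|\alpha(r)|,\qquad K=\sum_{l=1}^n \#\{k\neq l : a_{l,k}\neq 0\},$$ $$S=\max_{l=1,\dots,n}\ \max_{\substack{k=1,\dots,r\\ k\neq l}}|a_{l,k}|,\qquad R=\min_{l=1,\dots,n}|\Re(a_{l,l})|.$$ Let $\rho>0$ satisfy $$\rho<\begin{cases}\dfrac{R}{KS} & \text{if } KS/R\ge 1,\\[2mm] \left(\dfrac{R}{KS}\right)^{1/(d-1)} & \text{if } KS/R<1,\end{cases}$$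 where the bound is interpreted as $+\infty$ if $KS=0$. If $\mu>\rho$ and $\mathbb{D}^n(\rho)$ is forward invariant with respect to the flow $\varphi^t$, then the system $\dot z=F(z)$ is globally asymptotically stable (GAS) on $\mathbb{D}^n(\rho)$.
   Context: For $\rho>0$, $\mathbb{D}^n(\rho)=\{z\in\mathbb{C}^n: |z_1|<\rho,\dots,|z_n|<\rho\}$, with distinguished boundary $(\partial\mathbb{D}(\rho))^n$. For a multi-index $\alpha=(\alpha_1,\dots,\alpha_n)\in\mathbb{N}^n$ (with $0\in\mathbb{N}$), $|\alpha|=\alpha_1+\cdots+\alpha_n$ and $z^\alpha=z_1^{\alpha_1}\cdots z_n^{\alpha_n}$. The map $k\mapsto\alpha(k)$, $k\in\mathbb{N}=\{0,1,2,\dots\}$, enumerates $\mathbb{N}^n$ in the following (graded lexicographic) order: $\alpha(k_1)$ comes before $\alpha(k_2)$ if $|\alpha(k_1)|<|\alpha(k_2)|$, or if $|\alpha(k_1)|=|\alpha(k_2)|$ and $\alpha_j(k_1)>\alpha_j(k_2)$ for the smallest $j$ with $\alpha_j(k_1)\ne\alpha_j(k_2)$. Thus $\alpha(0)=0$ and, for $1\le l\le n$, $z^{\alpha(l)}=z_l$, so $a_{l,l}$ is the coefficient of $z_l$ in $F_l$, i.e. the $l$-th diagonal entry of $JF(0)$. The notation $\#$ is the cardinality of a set, $\Re$ the real part, and a maximum over an empty set of coefficients is $0$. The Hardy space $\mathbb{H}^2(\mathbb{D}^n(\mu))$ is the space of holomorphic $f:\mathbb{D}^n(\mu)\to\mathbb{C}$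 with $\|f\|^2=\lim_{r\to1^-}\int_{(\partial\mathbb{D}(\mu))^n}|f(r\omega)|^2\,dm_n(\omega)<\infty$, where $m_n$ is the normalized Lebesgue measure on $(\partial\mathbb{D}(\mu))^n$. $\mathbb{D}^n(\rho)$ is forward invariant if $\varphi^t(\mathbb{D}^n(\rho))\subset\mathbb{D}^n(\rho)$ for all $t\ge0$. The system is GAS on $\mathbb{D}^n(\rho)$ if the equilibrium $0$ is Lyapunov stable and $\varphi^t(z)\to0$ as $t\to+\infty$ for every $z\in\mathbb{D}^n(\rho)$. *)

theory Defs
  imports "HOL-Analysis.Analysis"
begin

section \<open>Multi-indices and monomials\<close>

definition mi_degree :: "('n::finite \<Rightarrow> nat) \<Rightarrow> nat" where
  "mi_degree \<beta> = (\<Sum>j\<in>UNIV. \<beta> j)"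

definition grlex_less :: "('n::{finite,linorder} \<Rightarrow> nat) \<Rightarrow> ('n \<Rightarrow> nat) \<Rightarrow> bool" where
  "grlex_less \<beta> \<gamma> \<longleftrightarrow>
     mi_degree \<beta> < mi_degree \<gamma> \<or>
     mi_degree \<beta> = mi_degree \<gamma> \<and> (\<exists>j. \<beta> j > \<gamma> j \<and> (\<forall>i<j. \<beta> i = \<gamma> i))"

text \<open>
  The enumeration \<open>k \<mapsto> \<alpha>(k)\<close>: the multi-index that has exactly \<open>k\<close> predecessors.
  That this is the order isomorphism from the naturals onto the multi-indices
  is shown in \<open>bij_multi_index\<close> and \<open>grlex_less_multi_index_iff\<close>.
\<close>

definition multi_index :: "nat \<Rightarrow> ('n::{finite,linorder} \<Rightarrow> nat)" where
  "multi_index k = (THE \<beta>. card {\<gamma>. grlex_less \<gamma> \<beta>} = k)"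

text \<open>
  The index type \<open>'n\<close> stands for \<open>{1,\<dots>,n}\<close>; \<open>pos l\<close> is the 1-based number of \<open>l\<close>.
  By \<open>multi_index_pos\<close>, the monomial numbered \<open>pos l\<close> is the coordinate \<open>z\<^sub>l\<close>.
\<close>

definition pos :: "'n::{finite,linorder} \<Rightarrow> nat" where
  "pos l = card {j. j \<le> l}"

definition monomial :: "complex^'n \<Rightarrow> ('n::finite \<Rightarrow> nat) \<Rightarrow> complex" where
  "monomial z \<beta> = (\<Prod>j\<in>UNIV. (z $ j) ^ \<beta> j)"

definition poly_field ::
    "('n::{finite,linorder} \<Rightarrow> nat \<Rightarrow> complex) \<Rightarrow> nat \<Rightarrow>
      complex^'n::{finite,linorder} \<Rightarrow> complex^'n::{finite,linorder}" where
  "poly_field a r z = (\<chi> l. \<Sum>k = 1..r. a l k * monomial z (multi_index k))"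

lemma finite_mi_degree_le: "finite {\<beta> :: 'n::finite \<Rightarrow> nat. mi_degree \<beta> \<le> m}"
proof (rule finite_subset)
  have "\<beta> j \<le> m" if "mi_degree \<beta> \<le> m" for \<beta> :: "'n \<Rightarrow> nat" and j
    using that member_le_sum[of j UNIV \<beta>] by (simp add: mi_degree_def)
  then show "{\<beta> :: 'n \<Rightarrow> nat. mi_degree \<beta> \<le> m} \<subseteq> Pi\<^sub>E UNIV (\<lambda>_. {..m})"
    by (auto simp: PiE_def)
  show "finite (Pi\<^sub>E (UNIV :: 'n set) (\<lambda>_. {..m}))"
    by (intro finite_PiE) auto
qed

lemma finite_grlex_below: "finite {\<gamma>. grlex_less \<gamma> \<beta>}"
  by (rule finite_subset[OF _ finite_mi_degree_le[of "mi_degree \<beta>"]])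
     (auto simp: grlex_less_def)

lemma grlex_less_irrefl: "\<not> grlex_less \<beta> \<beta>"
  by (auto simp: grlex_less_def)

lemma grlex_less_trans:
  assumes "grlex_less \<beta> \<gamma>" "grlex_less \<gamma> \<delta>"
  shows "grlex_less \<beta> \<delta>"
proof -
  have lex: "\<exists>j. \<beta> j > \<delta> j \<and> (\<forall>i<j. \<beta> i = \<delta> i)"
    if j: "\<beta> j > \<gamma> j" "\<forall>i<j. \<beta> i = \<gamma> i" and k: "\<gamma> k > \<delta> k" "\<forall>i<k. \<gamma> i = \<delta> i" for j k
  proof (cases j k rule: linorder_cases)
    case less
    then show ?thesis using j k by (intro exI[of _ j]) auto
  next
    case equal
    then show ?thesis using j k by (intro exI[of _ j]) auto
  next
    case greater
    then show ?thesis using j k by (intro exI[of _ k]) auto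
  qed
  show ?thesis
    using assms lex unfolding grlex_less_def by (elim disjE conjE exE) auto
qed

lemma grlex_less_linear: "grlex_less \<beta> \<gamma> \<or> \<beta> = \<gamma> \<or> grlex_less \<gamma> \<beta>"
proof (cases "\<beta> = \<gamma>")
  case False
  let ?D = "{j. \<beta> j \<noteq> \<gamma> j}"
  define j where "j = Min ?D"
  have ne: "?D \<noteq> {}" using False by auto
  have "\<beta> j \<noteq> \<gamma> j" using Min_in[OF _ ne] by (simp add: j_def)
  moreover have "\<forall>i<j. \<beta> i = \<gamma> i"
    using Min_le[of ?D] by (fastforce simp: j_def)
  ultimately show ?thesis
    unfolding grlex_less_def by (metis linorder_neqE_nat)
qed simp

lemma grlex_rank_mono:
  assumes "grlex_less \<beta> \<gamma>"
  shows "card {\<delta>. grlex_less \<delta> \<beta>} < card {\<delta>. grlex_less \<delta> \<gamma>}"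
  using assms grlex_less_trans grlex_less_irrefl
  by (intro psubset_card_mono finite_grlex_below) blast

lemma grlex_rank_eq_iff:
  "card {\<delta>. grlex_less \<delta> \<beta>} = card {\<delta>. grlex_less \<delta> \<gamma>} \<longleftrightarrow> \<beta> = \<gamma>"
  using grlex_less_linear[of \<beta> \<gamma>] grlex_rank_mono[of \<beta> \<gamma>] grlex_rank_mono[of \<gamma> \<beta>] by auto

lemma multi_index_rank [simp]: "multi_index (card {\<gamma>. grlex_less \<gamma> \<beta>}) = \<beta>"
  unfolding multi_index_def by (rule the_equality) (auto simp: grlex_rank_eq_iff)

lemma grlex_rank_surj:
  "\<exists>\<beta> :: 'n::{finite,linorder} \<Rightarrow> nat. card {\<gamma>. grlex_less \<gamma> \<beta>} = k"
proof (induction k)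
  case 0
  have "{\<gamma> :: 'n \<Rightarrow> nat. grlex_less \<gamma> (\<lambda>_. 0)} = {}"
    by (auto simp: grlex_less_def mi_degree_def)
  then show ?case by (metis card.empty)
next
  case (Suc k)
  then obtain \<beta> :: "'n \<Rightarrow> nat" where \<beta>: "card {\<gamma>. grlex_less \<gamma> \<beta>} = k" by blast
  let ?rank = "\<lambda>\<beta> :: 'n \<Rightarrow> nat. card {\<gamma>. grlex_less \<gamma> \<beta>}"
  have "mi_degree (\<lambda>_ :: 'n. Suc (mi_degree \<beta>)) > mi_degree \<beta>"
    using member_le_sum[of undefined UNIV "\<lambda>_ :: 'n. Suc (mi_degree \<beta>)"]
    by (simp add: mi_degree_def)
  then have ex: "\<exists>\<gamma>. grlex_less \<beta> \<gamma>" by (auto simp: grlex_less_def)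
  define \<delta> where "\<delta> = arg_min ?rank (grlex_less \<beta>)"
  have \<delta>: "grlex_less \<beta> \<delta>" "\<And>\<gamma>. grlex_less \<beta> \<gamma> \<Longrightarrow> ?rank \<delta> \<le> ?rank \<gamma>"
    using ex arg_min_natI[of "grlex_less \<beta>" _ ?rank] arg_min_nat_le[of "grlex_less \<beta>" _ ?rank]
    by (auto simp: \<delta>_def)
  have "grlex_less \<gamma> \<delta> \<longleftrightarrow> grlex_less \<gamma> \<beta> \<or> \<gamma> = \<beta>" for \<gamma>
    using \<delta> grlex_less_linear[of \<gamma> \<beta>] grlex_less_trans[of \<gamma> \<beta> \<delta>] grlex_rank_mono[of \<gamma> \<delta>]
    by (metis not_less)
  then have "{\<gamma>. grlex_less \<gamma> \<delta>} = insert \<beta> {\<gamma>. grlex_less \<gamma> \<beta>}" by auto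
  then have "?rank \<delta> = Suc k"
    using \<beta> finite_grlex_below[of \<beta>] grlex_less_irrefl[of \<beta>] by simp
  then show ?case by blast
qed

lemma rank_multi_index [simp]:
  "card {\<gamma> :: 'n::{finite,linorder} \<Rightarrow> nat. grlex_less \<gamma> (multi_index k)} = k"
  using grlex_rank_surj[where 'n = 'n, of k] multi_index_rank by metis

lemma bij_multi_index: "bij (multi_index :: nat \<Rightarrow> 'n::{finite,linorder} \<Rightarrow> nat)"
  by (rule o_bij[of "\<lambda>\<beta>. card {\<gamma>. grlex_less \<gamma> \<beta>}"]) (auto simp: fun_eq_iff)

lemma grlex_less_multi_index_iff:
  "grlex_less (multi_index j :: 'n::{finite,linorder} \<Rightarrow> nat) (multi_index k) \<longleftrightarrow> j < k"
  by (metis grlex_less_linear grlex_rank_mono less_asym' nat_neq_iff rank_multi_index)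

lemma multi_index_0: "multi_index 0 = (\<lambda>_ :: 'n::{finite,linorder}. 0 :: nat)"
proof -
  have "{\<gamma> :: 'n::{finite,linorder} \<Rightarrow> nat. grlex_less \<gamma> (\<lambda>_. 0)} = {}"
    by (auto simp: grlex_less_def mi_degree_def)
  then show ?thesis
    using multi_index_rank[of "\<lambda>_ :: 'n. 0"] by simp
qed

lemma multi_index_pos:
  fixes l :: "'n::{finite,linorder}"
  shows "multi_index (pos l) = (\<lambda>j. if j = l then 1 else 0 :: nat)"
proof -
  let ?e = "\<lambda>l j :: 'n. if j = l then 1 else 0 :: nat"
  have deg_e: "mi_degree (?e l) = 1" for l by (simp add: mi_degree_def)
  have deg0: "mi_degree \<gamma> = 0 \<longleftrightarrow> \<gamma> = (\<lambda>_. 0)" for \<gamma> :: "'n \<Rightarrow> nat"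
    by (auto simp: mi_degree_def)
  have deg1: "\<exists>m. \<gamma> = ?e m" if \<gamma>: "mi_degree \<gamma> = 1" for \<gamma> :: "'n \<Rightarrow> nat"
  proof -
    obtain m where "\<gamma> m = 1" "\<forall>j. m \<noteq> j \<longrightarrow> \<gamma> j = 0"
      using \<gamma> by (auto simp: mi_degree_def sum_eq_Suc0_iff)
    then show ?thesis by (intro exI[of _ m]) (auto simp: fun_eq_iff)
  qed
  have e_less: "grlex_less (?e m) (?e l) \<longleftrightarrow> m < l" for m l
  proof
    assume "grlex_less (?e m) (?e l)"
    then obtain j where "?e m j > ?e l j" "\<forall>i<j. ?e m i = ?e l i"
      unfolding grlex_less_def deg_e by blast
    then show "m < l" by (auto split: if_splits) (metis linorder_neqE zero_neq_one)
  next
    assume "m < l"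
    then show "grlex_less (?e m) (?e l)"
      unfolding grlex_less_def deg_e by (intro disjI2 conjI exI[of _ m]) auto
  qed
  have inj: "inj ?e" by (rule injI) (metis zero_neq_one)
  have "{\<gamma>. grlex_less \<gamma> (?e l)} = insert (\<lambda>_. 0) (?e ` {m. m < l})" (is "?A = ?B")
  proof
    show "?A \<subseteq> ?B"
    proof
      fix \<gamma> :: "'n \<Rightarrow> nat" assume "\<gamma> \<in> ?A"
      then have g: "grlex_less \<gamma> (?e l)" by simp
      then have "mi_degree \<gamma> \<le> 1" using deg_e[of l] unfolding grlex_less_def by linarith
      then consider "mi_degree \<gamma> = 0" | "mi_degree \<gamma> = 1" by linarith
      then show "\<gamma> \<in> ?B"
      proof cases
        case 1
        then show ?thesis using deg0[of \<gamma>] by simp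
      next
        case 2
        then obtain m where "\<gamma> = ?e m" using deg1 by blast
        then show ?thesis using g e_less[of m l] by blast
      qed
    qed
    have "grlex_less (\<lambda>_. 0) (?e l)"
      unfolding grlex_less_def deg_e by (simp add: mi_degree_def)
    then show "?B \<subseteq> ?A" using e_less by blast
  qed
  moreover have "(\<lambda>_. 0) \<notin> ?e ` {m. m < l}" by (auto simp: fun_eq_iff) (metis zero_neq_one)
  moreover have "card (?e ` {m. m < l}) = card {m. m < l}"
    using inj by (intro card_image) (auto intro: inj_on_subset)
  moreover have "{j. j \<le> l} = insert l {m. m < l}" by auto
  ultimately have "card {\<gamma>. grlex_less \<gamma> (?e l)} = pos l"
    by (simp add: pos_def)
  then show ?thesis using multi_index_rank[of "?e l"] by simp
qed


section \<open>Polydiscs, holomorphic functions of several variables, Hardy space\<close>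

definition polydisc :: "real \<Rightarrow> (complex^'n::finite) set" where
  "polydisc \<rho> = {z. \<forall>j. norm (z $ j) < \<rho>}"

text \<open>
  Holomorphic on \<open>A\<close> means complex differentiable on an open neighbourhood of \<open>A\<close>;
  for open \<open>A\<close> this is complex differentiability at every point of \<open>A\<close>.
\<close>

definition holomorphic_several :: "(complex^'n::finite \<Rightarrow> complex) \<Rightarrow> (complex^'n) set \<Rightarrow> bool" where
  "holomorphic_several f A \<longleftrightarrow>
     (\<exists>U. open U \<and> A \<subseteq> U \<and>
        (\<forall>z\<in>U. \<exists>L. (f has_derivative L) (at z) \<and> (\<forall>c v. L (c *s v) = c * L v)))"

text \<open>
  The normalized Lebesgue measure on the distinguished boundary of the polydisc of radius \<open>\<mu>\<close>
  is expressed by the angles: it is the image of the uniform distribution on \<open>[0, 2\<pi>]\<^sup>n\<close>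
  under \<open>torus_point \<mu>\<close>.
\<close>

definition torus_point :: "real \<Rightarrow> ('n::finite \<Rightarrow> real) \<Rightarrow> complex^'n" where
  "torus_point \<mu> \<theta> = (\<chi> j. complex_of_real \<mu> * cis (\<theta> j))"

definition angle_measure :: "('n::finite \<Rightarrow> real) measure" where
  "angle_measure = (\<Pi>\<^sub>M j\<in>UNIV. uniform_measure lborel {0..2 * pi})"

definition hardy2 :: "real \<Rightarrow> (complex^'n::finite \<Rightarrow> complex) set" where
  "hardy2 \<mu> = {f. holomorphic_several f (polydisc \<mu>) \<and>
     (\<exists>L<\<infinity>. ((\<lambda>s. \<integral>\<^sup>+\<theta>. ennreal ((norm (f (s *\<^sub>R torus_point \<mu> \<theta>)))\<^sup>2) \<partial>angle_measure)
               \<longlongrightarrow> L) (at_left 1))}"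


section \<open>Jacobian matrix and eigenvalues\<close>

definition complex_jacobian :: "(complex^'n::finite \<Rightarrow> complex^'n) \<Rightarrow> complex^'n \<Rightarrow> complex^'n^'n" where
  "complex_jacobian F z =
     (\<chi> l j. deriv (\<lambda>w. F (\<chi> i. if i = j then w else z $ i) $ l) (z $ j))"

definition matrix_eigenvalue :: "complex^'n^'n::finite \<Rightarrow> complex \<Rightarrow> bool" where
  "matrix_eigenvalue A c \<longleftrightarrow> (\<exists>v. v \<noteq> 0 \<and> A *v v = c *s v)"

definition diagonal_matrix :: "complex^'n^'n::finite \<Rightarrow> bool" where
  "diagonal_matrix A \<longleftrightarrow> (\<forall>i j. i \<noteq> j \<longrightarrow> A $ i $ j = 0)"

definition hyperbolic_equilibrium :: "(complex^'n::finite \<Rightarrow> complex^'n) \<Rightarrow> complex^'n \<Rightarrow> bool" where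
  "hyperbolic_equilibrium F z \<longleftrightarrow>
     F z = 0 \<and> (\<forall>c. matrix_eigenvalue (complex_jacobian F z) c \<longrightarrow> Re c \<noteq> 0)"


section \<open>Flows and stability\<close>

definition forward_invariant :: "(real \<Rightarrow> 'a \<Rightarrow> 'a) \<Rightarrow> 'a set \<Rightarrow> bool" where
  "forward_invariant \<phi> D \<longleftrightarrow> (\<forall>t\<ge>0. \<phi> t ` D \<subseteq> D)"

definition flow_generated_by ::
    "(complex^'n::finite \<Rightarrow> complex^'n) \<Rightarrow> (complex^'n) set \<Rightarrow> (real \<Rightarrow> complex^'n \<Rightarrow> complex^'n) \<Rightarrow> bool" where
  "flow_generated_by F D \<phi> \<longleftrightarrow>
     forward_invariant \<phi> D \<and>
     (\<forall>z\<in>D. \<phi> 0 z = z) \<and>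
     (\<forall>z\<in>D. \<forall>s\<ge>0. \<forall>t\<ge>0. \<phi> (s + t) z = \<phi> s (\<phi> t z)) \<and>
     (\<forall>z\<in>D. \<forall>t\<ge>0. ((\<lambda>s. \<phi> s z) has_vector_derivative F (\<phi> t z)) (at t within {0..}))"

definition holomorphic_flow :: "(complex^'n::finite) set \<Rightarrow> (real \<Rightarrow> complex^'n \<Rightarrow> complex^'n) \<Rightarrow> bool" where
  "holomorphic_flow D \<phi> \<longleftrightarrow> (\<forall>t\<ge>0. \<forall>l. holomorphic_several (\<lambda>z. \<phi> t z $ l) D)"

definition lyapunov_stable_at_0 :: "(real \<Rightarrow> 'a::real_normed_vector \<Rightarrow> 'a) \<Rightarrow> 'a set \<Rightarrow> bool" where
  "lyapunov_stable_at_0 \<phi> D \<longleftrightarrow>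
     (\<forall>\<epsilon>>0. \<exists>\<delta>>0. \<forall>z\<in>D. norm z < \<delta> \<longrightarrow> (\<forall>t\<ge>0. norm (\<phi> t z) < \<epsilon>))"

definition GAS :: "(real \<Rightarrow> 'a::real_normed_vector \<Rightarrow> 'a) \<Rightarrow> 'a set \<Rightarrow> bool" where
  "GAS \<phi> D \<longleftrightarrow> lyapunov_stable_at_0 \<phi> D \<and> (\<forall>z\<in>D. ((\<lambda>t. \<phi> t z) \<longlongrightarrow> 0) at_top)"


section \<open>Constants of the coefficient array\<close>

definition field_degree :: "('n::{finite,linorder} \<Rightarrow> nat \<Rightarrow> complex) \<Rightarrow> nat \<Rightarrow> nat" where
  "field_degree a r =
     Max {mi_degree (multi_index k :: 'n \<Rightarrow> nat) | k. k \<in> {1..r} \<and> (\<exists>l. a l k \<noteq> 0)}"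

definition off_count :: "('n::{finite,linorder} \<Rightarrow> nat \<Rightarrow> complex) \<Rightarrow> nat \<Rightarrow> nat" where
  "off_count a r = (\<Sum>l\<in>UNIV. card {k \<in> {1..r}. k \<noteq> pos l \<and> a l k \<noteq> 0})"

text \<open>Inserting \<open>0\<close> makes the maximum over an empty set of coefficients \<open>0\<close> and changes no other maximum.\<close>

definition off_max :: "('n::{finite,linorder} \<Rightarrow> nat \<Rightarrow> complex) \<Rightarrow> nat \<Rightarrow> real" where
  "off_max a r = (MAX l. Max (insert 0 ((\<lambda>k. norm (a l k)) ` {k \<in> {1..r}. k \<noteq> pos l})))"

definition diag_min :: "('n::{finite,linorder} \<Rightarrow> nat \<Rightarrow> complex) \<Rightarrow> real" where
  "diag_min a = (MIN l. \<bar>Re (a l (pos l))\<bar>)"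

definition radius_bound :: "real \<Rightarrow> real \<Rightarrow> real \<Rightarrow> nat \<Rightarrow> ereal" where
  "radius_bound K S R d =
     (if K * S = 0 then \<infinity>
      else if K * S / R \<ge> 1 then ereal (R / (K * S))
      else ereal ((R / (K * S)) powr (1 / (real d - 1))))"

end

(*
The maximum of the |z_l| is a strict Lyapunov function. Since JF(0) is diagonal, every
off-diagonal monomial of F has degree between 2 and d, so on the polydisc of radius rho the
nonlinear part of F_l is at most q * max_j |z_j| with q = K * S * max(rho, rho^(d-1)), and the
bound on rho gives q < R. The diagonal part contracts at rate at least R, so the
maximum decays exponentially.
*)
theory Submission
  imports Defs
begin

section \<open>Exponential decay of a finite family, controlled through its maximum\<close>

text \<open>
  Where the weighted family \<open>exp (\<kappa>' * t) * u l t\<close> is largest over all indices and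
  \<open>t \<in> [0, T]\<close>, its derivative is negative unless its value is \<open>0\<close>; so the maximum is
  attained at \<open>t = 0\<close>. Taking the maximum over \<open>t\<close> as well avoids Dini derivatives.
\<close>

lemma max_exponential_decay:
  fixes u u' :: "'n::finite \<Rightarrow> real \<Rightarrow> real"
  assumes deriv: "\<And>l t. t \<ge> 0 \<Longrightarrow> (u l has_real_derivative u' l t) (at t within {0..})"
    and nonneg: "\<And>l t. t \<ge> 0 \<Longrightarrow> u l t \<ge> 0"
    and decay: "\<And>l t. t \<ge> 0 \<Longrightarrow> (\<And>j. u j t \<le> u l t) \<Longrightarrow> u' l t \<le> - \<kappa> * u l t"
    and "\<kappa>' < \<kappa>"
    and init: "\<And>l. u l 0 \<le> B"
    and "T \<ge> 0"
  shows "u l T \<le> B * exp (- \<kappa>' * T)"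
proof -
  define v where "v l t = exp (\<kappa>' * t) * u l t" for l t
  have v_deriv: "(v l has_real_derivative exp (\<kappa>' * t) * (\<kappa>' * u l t + u' l t)) (at t within {0..})"
    if "t \<ge> 0" for l t
    unfolding v_def
    by (rule derivative_eq_intros deriv that refl | simp add: algebra_simps)+
  have "\<exists>s\<in>{0..T}. \<forall>t\<in>{0..T}. v l t \<le> v l s" for l
  proof (rule continuous_attains_sup)
    show "continuous_on {0..T} (v l)"
      by (rule DERIV_continuous_on, rule DERIV_subset[OF v_deriv]) auto
  qed (use \<open>T \<ge> 0\<close> in auto)
  then obtain s where s: "\<And>l. s l \<in> {0..T}" "\<And>l t. t \<in> {0..T} \<Longrightarrow> v l t \<le> v l (s l)"
    by metis
  have "Max (range (\<lambda>l. v l (s l))) \<in> range (\<lambda>l. v l (s l))" by (intro Max_in) auto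
  then obtain m where "Max (range (\<lambda>l. v l (s l))) = v m (s m)" by blast
  then have m: "v l (s l) \<le> v m (s m)" for l
    using Max_ge[of "range (\<lambda>l. v l (s l))" "v l (s l)"] by simp
  have sm: "s m \<ge> 0" using s(1)[of m] by simp
  have top: "v l t \<le> v m (s m)" if "t \<in> {0..T}" for l t
    using s(2)[OF that] m order_trans by blast
  \<comment> \<open>The weight \<open>exp (\<kappa>' * t)\<close> is the same for all indices, so at
    the time \<open>s m\<close> the index \<open>m\<close> also maximizes the unweighted family, as
    \<open>decay\<close> demands.\<close>
  have "u j (s m) \<le> u m (s m)" for j
    using top[OF s(1), of j m] by (simp add: v_def)
  then have slope: "u' m (s m) \<le> - \<kappa> * u m (s m)"
    by (intro decay sm)
  have "v m (s m) \<le> B"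
  proof (rule ccontr)
    assume less: "\<not> v m (s m) \<le> B"
    have "0 \<le> B" using nonneg[of 0 m] init[of m] by simp
    with less have "0 < v m (s m)" by simp
    then have "u m (s m) > 0" by (simp add: v_def zero_less_mult_iff)
    \<comment> \<open>The gap between \<open>\<kappa>'\<close> and \<open>\<kappa>\<close> makes
      this strict: the left side is at most
      \<open>(\<kappa>' - \<kappa>) * u m (s m)\<close>.\<close>
    then have "\<kappa>' * u m (s m) + u' m (s m) < 0"
      using slope mult_strict_right_mono[OF \<open>\<kappa>' < \<kappa>\<close>, of "u m (s m)"] by linarith
    then have "exp (\<kappa>' * s m) * (\<kappa>' * u m (s m) + u' m (s m)) < 0"
      by (simp add: mult_less_0_iff)
    from has_real_derivative_neg_dec_left[OF v_deriv[OF sm] this]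
    obtain e where e: "e > 0" "\<And>h. 0 < h \<Longrightarrow> s m - h \<in> {0..} \<Longrightarrow> h < e \<Longrightarrow> v m (s m) < v m (s m - h)"
      by blast
    \<comment> \<open>At time 0 the weight is 1, so \<open>v m 0\<close> is at most
      \<open>B\<close>. Hence there is room to the left of \<open>s m\<close>, where the negative
      slope produces a value above the maximum.\<close>
    have "s m \<noteq> 0" using less init[of m] by (auto simp: v_def)
    then have "s m > 0" using sm by simp
    define h where "h = min (s m) (e / 2)"
    have "0 < h" "h < e" "h \<le> s m" using \<open>s m > 0\<close> e(1) by (auto simp: h_def min_def)
    then have "v m (s m) < v m (s m - h)" using e(2)[of h] by simp
    moreover have "s m - h \<in> {0..T}" using s(1)[of m] \<open>0 < h\<close> \<open>h \<le> s m\<close> by auto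
    ultimately show False using top[of "s m - h" m] by simp
  qed
  then have "v l T \<le> B"
    using top[of T l] \<open>T \<ge> 0\<close> by simp
  then show ?thesis
    by (simp add: v_def exp_minus field_simps)
qed

section \<open>Linear monomials and the Jacobian matrix at the origin\<close>

lemma pos_ge_1: "1 \<le> pos (l :: 'n::{finite,linorder})"
  by (simp add: pos_def Suc_le_eq card_gt_0_iff) blast

lemma multi_index_eq_unit_iff:
  "multi_index k = (\<lambda>i. if i = j then 1 else 0 :: nat) \<longleftrightarrow> k = pos (j :: 'n::{finite,linorder})"
  unfolding multi_index_pos[symmetric] by (rule inj_eq[OF bij_is_inj[OF bij_multi_index]])

text \<open>Degree 0 occurs only at number 0, and the multi-indices of degree 1 are the unit
  vectors, which carry the numbers \<open>pos j\<close>.\<close>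

lemma mi_degree_multi_index_ge_2:
  assumes "k \<ge> 1" "\<And>j. k \<noteq> pos (j :: 'n::{finite,linorder})"
  shows "2 \<le> mi_degree (multi_index k :: 'n \<Rightarrow> nat)"
proof (rule ccontr)
  let ?\<beta> = "multi_index k :: 'n \<Rightarrow> nat"
  assume "\<not> 2 \<le> mi_degree ?\<beta>"
  then consider "mi_degree ?\<beta> = 0" | "mi_degree ?\<beta> = 1" by linarith
  then show False
  proof cases
    case 1
    then have "?\<beta> = multi_index 0" by (simp add: mi_degree_def multi_index_0 fun_eq_iff)
    then have "k = 0" by (rule injD[OF bij_is_inj[OF bij_multi_index]])
    with assms show False by simp
  next
    case 2
    then obtain j where "?\<beta> j = 1" "\<forall>i. j \<noteq> i \<longrightarrow> ?\<beta> i = 0"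
      by (auto simp: mi_degree_def sum_eq_Suc0_iff)
    then have "?\<beta> = (\<lambda>i. if i = j then 1 else 0)" by auto
    with assms(2) multi_index_eq_unit_iff show False by blast
  qed
qed

text \<open>On the \<open>j\<close>-th axis a monomial is the pure power
  \<open>w ^ \<beta> j\<close> if no other variable occurs in it, and vanishes identically
  otherwise. Only exponent 1 gives a nonzero slope at 0.\<close>

lemma monomial_axis_has_derivative:
  fixes j :: "'n::finite"
  shows "((\<lambda>w. monomial (\<chi> i. if i = j then w else 0) \<beta>) has_field_derivative
           (if \<beta> = (\<lambda>i. if i = j then 1 else 0) then 1 else 0)) (at 0)"
proof (cases "\<forall>i. i \<noteq> j \<longrightarrow> \<beta> i = 0")
  case True
  have "monomial (\<chi> i. if i = j then w else 0) \<beta> = w ^ \<beta> j" for w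
  proof -
    have "monomial (\<chi> i. if i = j then w else 0) \<beta> = (\<Prod>i\<in>UNIV. if i = j then w ^ \<beta> j else 1)"
      unfolding monomial_def using True by (intro prod.cong) auto
    then show ?thesis by simp
  qed
  moreover have "(\<beta> = (\<lambda>i. if i = j then 1 else 0)) \<longleftrightarrow> \<beta> j = 1"
    using True by (auto simp: fun_eq_iff)
  moreover have "((\<lambda>w :: complex. w ^ \<beta> j) has_field_derivative (if \<beta> j = 1 then 1 else 0)) (at 0)"
    by (rule derivative_eq_intros refl)+ (auto simp: power_0_left)
  ultimately show ?thesis by simp
next
  case False
  then obtain i where i: "i \<noteq> j" "\<beta> i \<noteq> 0" by blast
  then have "monomial (\<chi> i. if i = j then w else 0) \<beta> = 0" for w
    unfolding monomial_def by (intro prod_zero) (auto intro!: bexI[of _ i])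
  moreover have "\<beta> \<noteq> (\<lambda>i. if i = j then 1 else 0)" using i by auto
  ultimately show ?thesis by simp
qed

text \<open>Differentiating along the axis at 0 leaves only the monomial \<open>z $ j\<close>,
  numbered \<open>pos j\<close>. If \<open>r\<close> cuts the sum off before it, the entry is 0
  whatever value the array \<open>a\<close> has there.\<close>

lemma complex_jacobian_poly_field_0:
  fixes a :: "'n::{finite,linorder} \<Rightarrow> nat \<Rightarrow> complex"
  shows "complex_jacobian (poly_field a r) 0 $ l $ j = (if pos j \<le> r then a l (pos j) else 0)"
proof -
  have "((\<lambda>w. poly_field a r (\<chi> i. if i = j then w else 0) $ l) has_field_derivative
          (\<Sum>k = 1..r. a l k * (if multi_index k = (\<lambda>i. if i = j then 1 else 0) then 1 else 0))) (at 0)"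
    unfolding poly_field_def vec_lambda_beta
    by (intro DERIV_sum DERIV_cmult monomial_axis_has_derivative)
  from DERIV_imp_deriv[OF this]
  have "complex_jacobian (poly_field a r) 0 $ l $ j = (\<Sum>k = 1..r. if k = pos j then a l k else 0)"
    unfolding multi_index_eq_unit_iff
    by (simp add: complex_jacobian_def if_distrib cong: if_cong)
  then show ?thesis
    using pos_ge_1[of j] by (simp add: sum.delta)
qed

text \<open>The unit vector \<open>axis l 1\<close> is an eigenvector. This turns the spectral
  hypothesis into a sign condition on the diagonal entries.\<close>

lemma diagonal_matrix_eigenvalue:
  assumes "diagonal_matrix A"
  shows "matrix_eigenvalue A (A $ l $ l)"
  unfolding matrix_eigenvalue_def
proof (intro exI conjI)
  show "axis l 1 \<noteq> (0 :: complex^'a)" by simp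
  have "(\<Sum>j\<in>UNIV. A $ i $ j * (if j = l then 1 else 0)) = A $ i $ l" for i
    by (simp add: if_distrib cong: if_cong)
  then show "A *v axis l 1 = A $ l $ l *s axis l 1"
    using assms by (auto simp: vec_eq_iff matrix_vector_mult_def axis_def diagonal_matrix_def)
qed

section \<open>Size of the off-diagonal terms and the radius condition\<close>

lemma norm_monomial_le:
  assumes "\<And>j. norm (z $ j) \<le> m"
  shows "norm (monomial z \<beta>) \<le> m ^ mi_degree \<beta>"
proof -
  have "norm (monomial z \<beta>) \<le> (\<Prod>j\<in>UNIV. m ^ \<beta> j)"
    unfolding monomial_def prod_norm[symmetric] norm_power
    by (intro prod_mono conjI power_mono assms) auto
  then show ?thesis by (simp add: mi_degree_def power_sum)
qed

text \<open>After one factor \<open>m\<close> is split off, the exponent \<open>e - 1\<close> lies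
  between 1 and \<open>d - 1\<close>. Powers of \<open>\<rho>\<close> are monotone in the exponent,
  so one of the two extremes dominates, according to whether \<open>\<rho> \<le> 1\<close>.\<close>

lemma power_le_linear:
  fixes m \<rho> :: real
  assumes "0 \<le> m" "m \<le> \<rho>" "2 \<le> e" "e \<le> d"
  shows "m ^ e \<le> max \<rho> (\<rho> ^ (d - 1)) * m"
proof -
  have "m ^ (e - 1) \<le> \<rho> ^ (e - 1)" using assms by (intro power_mono) auto
  also have "\<dots> \<le> max \<rho> (\<rho> ^ (d - 1))"
  proof (cases "\<rho> \<le> 1")
    case True
    then have "\<rho> ^ (e - 1) \<le> \<rho> ^ 1" using assms by (intro power_decreasing) auto
    then show ?thesis by simp
  next
    case False
    then have "\<rho> ^ (e - 1) \<le> \<rho> ^ (d - 1)" using assms by (intro power_increasing) auto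
    then show ?thesis by simp
  qed
  finally have "m ^ (e - 1) * m \<le> max \<rho> (\<rho> ^ (d - 1)) * m"
    using assms(1) by (rule mult_right_mono)
  moreover have "m ^ e = m ^ (e - 1) * m"
    using assms(3) by (cases e) simp_all
  ultimately show ?thesis by simp
qed

lemma norm_coeff_le_off_max:
  fixes a :: "'n::{finite,linorder} \<Rightarrow> nat \<Rightarrow> complex"
  assumes "k \<in> {1..r}" "k \<noteq> pos l"
  shows "norm (a l k) \<le> off_max a r"
proof -
  let ?M = "\<lambda>l. Max (insert 0 ((\<lambda>k. norm (a l k)) ` {k \<in> {1..r}. k \<noteq> pos l}))"
  have "norm (a l k) \<le> ?M l" using assms by (intro Max_ge) auto
  also have "?M l \<le> off_max a r" unfolding off_max_def by (intro Max_ge) auto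
  finally show ?thesis .
qed

lemma off_max_nonneg: "0 \<le> off_max (a :: 'n::{finite,linorder} \<Rightarrow> nat \<Rightarrow> complex) r"
proof -
  let ?M = "\<lambda>l. Max (insert 0 ((\<lambda>k. norm (a l k)) ` {k \<in> {1..r}. k \<noteq> pos l}))"
  have "0 \<le> ?M undefined" by (intro Max_ge) auto
  also have "?M undefined \<le> off_max a r" unfolding off_max_def by (intro Max_ge) auto
  finally show ?thesis .
qed

lemma mi_degree_le_field_degree:
  fixes a :: "'n::{finite,linorder} \<Rightarrow> nat \<Rightarrow> complex"
  assumes "k \<in> {1..r}" "a l k \<noteq> 0"
  shows "mi_degree (multi_index k :: 'n \<Rightarrow> nat) \<le> field_degree a r"
  unfolding field_degree_def using assms by (intro Max_ge) auto

text \<open>Each term with a nonzero coefficient has degree at least 2 and is thus linearly small in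
  \<open>m\<close>, by \<open>power_le_linear\<close>; it remains to count these terms.\<close>

lemma off_diagonal_bound:
  fixes a :: "'n::{finite,linorder} \<Rightarrow> nat \<Rightarrow> complex" and z :: "complex^'n::{finite,linorder}"
  assumes deg: "\<And>l k. k \<in> {1..r} \<Longrightarrow> k \<noteq> pos l \<Longrightarrow> a l k \<noteq> 0 \<Longrightarrow>
      2 \<le> mi_degree (multi_index k :: 'n \<Rightarrow> nat)"
    and z: "\<And>j. norm (z $ j) \<le> m" and m: "m \<le> \<rho>"
  shows "norm (\<Sum>k\<in>{1..r} - {pos l}. a l k * monomial z (multi_index k))
    \<le> real (off_count a r) * off_max a r * max \<rho> (\<rho> ^ (field_degree a r - 1)) * m"
proof -
  let ?I = "{k \<in> {1..r}. k \<noteq> pos l \<and> a l k \<noteq> 0}"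
  let ?C = "off_max a r * (max \<rho> (\<rho> ^ (field_degree a r - 1)) * m)"
  have "0 \<le> m" using z order_trans norm_ge_zero by blast
  then have "0 \<le> ?C" using m off_max_nonneg[of a r] by (auto simp: max_def)
  have "norm (a l k * monomial z (multi_index k)) \<le> ?C" if k: "k \<in> ?I" for k
    unfolding norm_mult
  proof (rule mult_mono)
    show "norm (a l k) \<le> off_max a r" using k by (intro norm_coeff_le_off_max) auto
    have "norm (monomial z (multi_index k)) \<le> m ^ mi_degree (multi_index k :: 'n \<Rightarrow> nat)"
      by (rule norm_monomial_le[OF z])
    also have "\<dots> \<le> max \<rho> (\<rho> ^ (field_degree a r - 1)) * m"
      using k by (intro power_le_linear \<open>0 \<le> m\<close> m deg[of k l] mi_degree_le_field_degree[of k r a l]) auto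
    finally show "norm (monomial z (multi_index k)) \<le> max \<rho> (\<rho> ^ (field_degree a r - 1)) * m" .
  qed (use off_max_nonneg in auto)
  then have "norm (\<Sum>k\<in>?I. a l k * monomial z (multi_index k)) \<le> (\<Sum>k\<in>?I. ?C)"
    by (rule sum_norm_le)
  also have "(\<Sum>k\<in>?I. ?C) = real (card ?I) * ?C" by simp
  \<comment> \<open>\<open>off_count\<close> adds up the terms of all components, so it dominates
    the count for the single component \<open>l\<close>.\<close>
  also have "\<dots> \<le> real (off_count a r) * ?C"
    using \<open>0 \<le> ?C\<close> unfolding off_count_def
    by (intro mult_right_mono of_nat_mono member_le_sum[of l UNIV "\<lambda>l. card {k \<in> {1..r}. k \<noteq> pos l \<and> a l k \<noteq> 0}"]) auto
  also have "(\<Sum>k\<in>?I. a l k * monomial z (multi_index k)) =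
      (\<Sum>k\<in>{1..r} - {pos l}. a l k * monomial z (multi_index k))"
    by (rule sum.mono_neutral_left) auto
  finally show ?thesis by (simp add: mult.assoc)
qed

text \<open>With \<open>c = K * S\<close>, both \<open>c * \<rho>\<close> and
  \<open>c * \<rho> ^ (d - 1)\<close> must stay below \<open>R\<close>. If \<open>c \<ge> R\<close>,
  then \<open>\<rho> < 1\<close> and the first product is the larger one. If \<open>c < R\<close>,
  the root in the bound controls the second product; the first is at most \<open>c\<close> when
  \<open>\<rho> \<le> 1\<close> and at most the second otherwise. The condition on \<open>d\<close>
  is conditional because a linear field has \<open>d = 1\<close>.\<close>

lemma radius_bound_gain:
  fixes K S R \<rho> :: real
  assumes "0 < R" "0 \<le> K * S" "0 < \<rho>" "ereal \<rho> < radius_bound K S R d"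
    and d: "K * S \<noteq> 0 \<Longrightarrow> 2 \<le> d"
  shows "K * S * max \<rho> (\<rho> ^ (d - 1)) < R"
proof (cases "K * S = 0")
  case True
  then show ?thesis using assms(1) by auto
next
  case False
  define c where "c = K * S"
  have "c > 0" "d \<ge> 2" using False assms(2) d by (simp_all add: c_def order_less_le)
  have "c * \<rho> < R \<and> c * \<rho> ^ (d - 1) < R"
  proof (cases "c / R \<ge> 1")
    case True
    then have "\<rho> < R / c" using assms(4) False by (simp add: radius_bound_def c_def)
    moreover have "R / c \<le> 1" using True \<open>c > 0\<close> \<open>0 < R\<close> by (simp add: field_simps)
    ultimately have "\<rho> ^ (d - 1) \<le> \<rho> ^ 1"
      using \<open>d \<ge> 2\<close> \<open>0 < \<rho>\<close> by (intro power_decreasing) auto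
    then have "c * \<rho> ^ (d - 1) \<le> c * \<rho>" using \<open>c > 0\<close> by simp
    moreover have "c * \<rho> < R" using \<open>\<rho> < R / c\<close> \<open>c > 0\<close> by (simp add: field_simps)
    ultimately show ?thesis by linarith
  next
    case c: False
    then have "c < R" using \<open>0 < R\<close> by (simp add: field_simps)
    have "\<rho> < (R / c) powr (1 / (real d - 1))"
      using assms(4) False c by (simp add: radius_bound_def c_def)
    then have "\<rho> powr (real d - 1) < ((R / c) powr (1 / (real d - 1))) powr (real d - 1)"
      using \<open>0 < \<rho>\<close> \<open>d \<ge> 2\<close> by (intro powr_less_mono2) auto
    also have "\<dots> = R / c" using \<open>d \<ge> 2\<close> \<open>c > 0\<close> \<open>0 < R\<close> by (simp add: powr_powr)
    also have "\<rho> powr (real d - 1) = \<rho> ^ (d - 1)"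
      using \<open>0 < \<rho>\<close> \<open>d \<ge> 2\<close> by (simp add: powr_realpow[symmetric] of_nat_diff)
    finally have high: "c * \<rho> ^ (d - 1) < R" using \<open>c > 0\<close> by (simp add: field_simps)
    have "c * \<rho> < R"
    proof (cases "\<rho> \<le> 1")
      case True
      then have "c * \<rho> \<le> c" using \<open>c > 0\<close> by simp
      then show ?thesis using \<open>c < R\<close> by simp
    next
      case False
      then have "\<rho> ^ 1 \<le> \<rho> ^ (d - 1)" using \<open>d \<ge> 2\<close> by (intro power_increasing) auto
      then have "c * \<rho> \<le> c * \<rho> ^ (d - 1)" using \<open>c > 0\<close> by simp
      then show ?thesis using high by simp
    qed
    with high show ?thesis by blast
  qed
  then show ?thesis by (simp add: c_def max_def)
qed

section \<open>From decay of the components to asymptotic stability\<close>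

text \<open>The Euclidean norm is at most the sum of the component norms, which costs a factor
  \<open>CARD('n)\<close>. The uniform exponential bound then gives attraction, and stability with
  \<open>\<delta> = \<epsilon> / CARD('n)\<close>.\<close>

lemma GAS_if_componentwise_decay:
  fixes \<phi> :: "real \<Rightarrow> complex^'n::finite \<Rightarrow> complex^'n"
  assumes "0 < \<kappa>"
    and decay: "\<And>z t l. z \<in> D \<Longrightarrow> 0 \<le> t \<Longrightarrow> norm (\<phi> t z $ l) \<le> norm z * exp (- \<kappa> * t)"
  shows "GAS \<phi> D"
proof -
  let ?n = "real CARD('n)"
  have bound: "norm (\<phi> t z) \<le> ?n * norm z * exp (- \<kappa> * t)" if "z \<in> D" "0 \<le> t" for t z
  proof -
    have "norm (\<phi> t z) \<le> (\<Sum>l\<in>UNIV. norm (\<phi> t z $ l))"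
      unfolding norm_vec_def by (rule L2_set_le_sum) simp
    also have "\<dots> \<le> (\<Sum>l\<in>(UNIV :: 'n set). norm z * exp (- \<kappa> * t))"
      by (intro sum_mono decay that)
    finally show ?thesis by (simp add: mult.assoc)
  qed
  have "lyapunov_stable_at_0 \<phi> D"
    unfolding lyapunov_stable_at_0_def
  proof (intro allI impI)
    fix \<epsilon> :: real assume "\<epsilon> > 0"
    show "\<exists>\<delta>>0. \<forall>z\<in>D. norm z < \<delta> \<longrightarrow> (\<forall>t\<ge>0. norm (\<phi> t z) < \<epsilon>)"
    proof (intro exI[of _ "\<epsilon> / ?n"] conjI ballI impI allI)
      fix z t assume *: "z \<in> D" "norm z < \<epsilon> / ?n" "(0::real) \<le> t"
      have "norm (\<phi> t z) \<le> ?n * norm z * exp (- \<kappa> * t)" by (rule bound) fact+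
      also have "\<dots> \<le> ?n * norm z * 1"
        using \<open>0 < \<kappa>\<close> * by (intro mult_left_mono) auto
      also have "\<dots> < \<epsilon>" using * by (simp add: field_simps)
      finally show "norm (\<phi> t z) < \<epsilon>" .
    qed (use \<open>\<epsilon> > 0\<close> in simp)
  qed
  moreover have "((\<lambda>t. \<phi> t z) \<longlongrightarrow> 0) at_top" if "z \<in> D" for z
  proof (rule Lim_null_comparison)
    show "\<forall>\<^sub>F t in at_top. norm (\<phi> t z) \<le> ?n * norm z * exp (- \<kappa> * t)"
      using eventually_ge_at_top[of 0] by eventually_elim (rule bound[OF that])
    have "((\<lambda>t. exp (- \<kappa> * t)) \<longlongrightarrow> 0) at_top"
      using \<open>0 < \<kappa>\<close>
      by (intro filterlim_compose[OF exp_at_bot] filterlim_tendsto_neg_mult_at_bot[OF tendsto_const] filterlim_ident) auto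
    then show "((\<lambda>t. ?n * norm z * exp (- \<kappa> * t)) \<longlongrightarrow> 0) at_top"
      by (rule tendsto_mult_right_zero)
  qed
  ultimately show ?thesis by (simp add: GAS_def)
qed

section \<open>The Lyapunov estimate along trajectories\<close>

theorem theorem1:
  fixes a :: "'n::{finite,linorder} \<Rightarrow> nat \<Rightarrow> complex"
    and F :: "complex^'n::{finite,linorder} \<Rightarrow> complex^'n::{finite,linorder}"
    and \<phi> :: "real \<Rightarrow> complex^'n::{finite,linorder} \<Rightarrow> complex^'n::{finite,linorder}"
    and r d :: nat
    and \<mu> \<rho> K S R :: real
  assumes "\<mu> > 0"
    and "F = poly_field a r"
    and "\<And>l. holomorphic_several (\<lambda>z. F z $ l) (closure (polydisc \<mu>))"
    and "\<And>l. (\<lambda>z. F z $ l) \<in> hardy2 \<mu>"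
    and "flow_generated_by F (polydisc \<mu>) \<phi>"
    and "holomorphic_flow (polydisc \<mu>) \<phi>"
    and "{z \<in> polydisc \<mu>. F z = 0} = {0}"
    and "hyperbolic_equilibrium F 0"
    and "\<And>c. matrix_eigenvalue (complex_jacobian F 0) c \<Longrightarrow> Re c < 0"
    and "diagonal_matrix (complex_jacobian F 0)"
    and "d = field_degree a r"
    and "d = mi_degree (multi_index r :: 'n \<Rightarrow> nat)"
    and "K = real (off_count a r)"
    and "S = off_max a r"
    and "R = diag_min a"
    and "\<rho> > 0"
    and "ereal \<rho> < radius_bound K S R d"
    and "\<mu> > \<rho>"
    and "forward_invariant \<phi> (polydisc \<rho>)"
  shows "GAS \<phi> (polydisc \<rho>)"
proof -
  \<comment> \<open>If \<open>pos l\<close> exceeded \<open>r\<close>, the diagonal entry would be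
    0, an eigenvalue whose real part is not negative.\<close>
  have diag: "pos l \<le> r \<and> Re (a l (pos l)) < 0" for l
    using assms(9)[OF diagonal_matrix_eigenvalue[OF assms(10), of l]]
    by (simp add: assms(2) complex_jacobian_poly_field_0 split: if_splits)
  have "0 < R"
    unfolding assms(15) diag_min_def using diag by (subst Min_gr_iff) (auto simp: less_imp_neq)
  have R_le: "R \<le> - Re (a l (pos l))" for l
  proof -
    have "R \<le> \<bar>Re (a l (pos l))\<bar>" unfolding assms(15) diag_min_def by (intro Min_le) auto
    then show ?thesis using diag[of l] by simp
  qed
  \<comment> \<open>A linear term in a foreign variable would be a nonzero off-diagonal entry of the
    Jacobian matrix.\<close>
  have deg: "2 \<le> mi_degree (multi_index k :: 'n \<Rightarrow> nat)"
    if "k \<in> {1..r}" "k \<noteq> pos l" "a l k \<noteq> 0" for l k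
  proof (rule mi_degree_multi_index_ge_2)
    show "k \<noteq> pos j" for j :: 'n
    proof
      assume "k = pos j"
      then have "complex_jacobian F 0 $ l $ j = a l k"
        using that by (simp add: assms(2) complex_jacobian_poly_field_0)
      moreover have "l \<noteq> j" using that \<open>k = pos j\<close> by auto
      ultimately show False using assms(10) that by (simp add: diagonal_matrix_def)
    qed
  qed (use that in auto)
  define q where "q = K * S * max \<rho> (\<rho> ^ (d - 1))"
  have "q < R" unfolding q_def
  proof (rule radius_bound_gain)
    show "0 \<le> K * S" using off_max_nonneg[of a r] by (simp add: assms(13,14))
    \<comment> \<open>Some off-diagonal coefficient is then nonzero, and the degree of its monomial
      lies between 2 and \<open>d\<close>.\<close>
    assume "K * S \<noteq> 0"
    then have "off_count a r \<noteq> 0" by (auto simp: assms(13))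
    then obtain l where "card {k \<in> {1..r}. k \<noteq> pos l \<and> a l k \<noteq> 0} \<noteq> 0"
      unfolding off_count_def by (auto simp: sum_eq_0_iff)
    then have "{k \<in> {1..r}. k \<noteq> pos l \<and> a l k \<noteq> 0} \<noteq> {}" by (metis card.empty)
    then obtain k where k: "k \<in> {1..r}" "k \<noteq> pos l" "a l k \<noteq> 0" by blast
    then show "2 \<le> d"
      using deg[OF k] mi_degree_le_field_degree[of k r a l] k by (simp add: assms(11))
  qed (fact \<open>0 < R\<close> assms(16,17))+
  \<comment> \<open>The real inner product is half the time derivative of the squared modulus of the
    \<open>l\<close>-th component. It is estimated only where that modulus is the largest, so that
    \<open>off_diagonal_bound\<close> applies with \<open>m = norm (z $ l)\<close>.\<close>
  have contraction: "z $ l \<bullet> F z $ l \<le> - (R - q) * (norm (z $ l))\<^sup>2"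
    if z: "z \<in> polydisc \<rho>" and top: "\<And>j. norm (z $ j) \<le> norm (z $ l)" for z l
  proof -
    let ?g = "\<Sum>k\<in>{1..r} - {pos l}. a l k * monomial z (multi_index k)"
    have "monomial z (multi_index (pos l)) = z $ l"
      by (simp add: monomial_def multi_index_pos if_distrib cong: if_cong)
    moreover have "pos l \<in> {1..r}" using diag[of l] pos_ge_1[of l] by simp
    ultimately have F: "F z $ l = a l (pos l) * z $ l + ?g"
      by (simp only: assms(2) poly_field_def vec_lambda_beta sum.remove[of "{1..r}" "pos l"] finite_atLeastAtMost)
    have "norm ?g \<le> q * norm (z $ l)"
      unfolding q_def assms(11,13,14)
      by (rule off_diagonal_bound[where a = a, OF deg top]) (use z in \<open>auto simp: polydisc_def less_imp_le\<close>)
    then have "z $ l \<bullet> ?g \<le> norm (z $ l) * (q * norm (z $ l))"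
      by (intro order_trans[OF norm_cauchy_schwarz] mult_left_mono) auto
    \<comment> \<open>The imaginary part of the diagonal coefficient only rotates
      \<open>z $ l\<close> and drops out of the inner product.\<close>
    moreover have "z $ l \<bullet> (a l (pos l) * z $ l) = Re (a l (pos l)) * (norm (z $ l))\<^sup>2"
      unfolding cmod_power2 by (simp add: inner_complex_def algebra_simps power2_eq_square)
    moreover have "Re (a l (pos l)) * (norm (z $ l))\<^sup>2 \<le> - R * (norm (z $ l))\<^sup>2"
      using R_le[of l] by (intro mult_right_mono) auto
    ultimately show ?thesis
      by (simp add: F inner_add_right algebra_simps power2_eq_square)
  qed
  show ?thesis
  proof (rule GAS_if_componentwise_decay)
    show "0 < (R - q) / 2" using \<open>q < R\<close> by simp
    fix z :: "complex^'n::{finite,linorder}" and t :: real and l :: 'n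
    assume z: "z \<in> polydisc \<rho>" and t: "0 \<le> t"
    \<comment> \<open>Forward invariance keeps the whole trajectory in the region where
      \<open>contraction\<close> holds.\<close>
    have inv: "\<phi> s z \<in> polydisc \<rho>" if "s \<ge> 0" for s
      using assms(19) z that by (auto simp: forward_invariant_def)
    have "z \<in> polydisc \<mu>" using z assms(18) by (auto simp: polydisc_def intro: less_trans)
    then have start: "\<phi> 0 z = z"
      and flow: "\<And>s. 0 \<le> s \<Longrightarrow> ((\<lambda>s. \<phi> s z) has_vector_derivative F (\<phi> s z)) (at s within {0..})"
      using assms(5) by (auto simp: flow_generated_by_def)
    \<comment> \<open>Squared moduli are differentiable even at 0. They contract at rate
      \<open>2 * (R - q)\<close>; the smaller rate \<open>R - q\<close> supplies the strict gap that
      \<open>max_exponential_decay\<close> needs, and the square root halves it to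
      \<open>(R - q) / 2\<close>.\<close>
    have "(norm (\<phi> t z $ l))\<^sup>2 \<le> (norm z)\<^sup>2 * exp (- (R - q) * t)"
    proof (rule max_exponential_decay[where u' = "\<lambda>l s. 2 * (\<phi> s z $ l \<bullet> F (\<phi> s z) $ l)"
          and \<kappa> = "2 * (R - q)"])
      fix l s assume s: "(0 :: real) \<le> s"
      have comp: "((\<lambda>s. \<phi> s z $ l) has_vector_derivative F (\<phi> s z) $ l) (at s within {0..})"
        by (rule bounded_linear.has_vector_derivative[OF bounded_linear_vec_nth flow[OF s]])
      show "((\<lambda>s. (norm (\<phi> s z $ l))\<^sup>2) has_real_derivative
          2 * (\<phi> s z $ l \<bullet> F (\<phi> s z) $ l)) (at s within {0..})"
        using bounded_bilinear.has_vector_derivative[OF bounded_bilinear_inner comp comp]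
        by (simp add: power2_norm_eq_inner has_real_derivative_iff_has_vector_derivative inner_commute)
      assume "\<And>j. (norm (\<phi> s z $ j))\<^sup>2 \<le> (norm (\<phi> s z $ l))\<^sup>2"
      then have "norm (\<phi> s z $ j) \<le> norm (\<phi> s z $ l)" for j
        by (meson norm_ge_zero power2_le_imp_le)
      from contraction[OF inv[OF s] this]
      show "2 * (\<phi> s z $ l \<bullet> F (\<phi> s z) $ l) \<le> - (2 * (R - q)) * (norm (\<phi> s z $ l))\<^sup>2"
        by (simp add: algebra_simps)
    next
      show "(norm (\<phi> 0 z $ l))\<^sup>2 \<le> (norm z)\<^sup>2" for l
        by (simp add: start power_mono Finite_Cartesian_Product.norm_nth_le)
    qed (use \<open>q < R\<close> t in auto)
    also have "\<dots> = (norm z * exp (- ((R - q) / 2) * t))\<^sup>2"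
      by (simp add: power_mult_distrib exp_double[symmetric] field_simps)
    finally show "norm (\<phi> t z $ l) \<le> norm z * exp (- ((R - q) / 2) * t)"
      by (rule power2_le_imp_le) simp
  qed
qed

end
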